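(* Let $n\ge 2$, $\alpha,\beta\in(0,\infty)$, $a=\alpha^{-1}$, $b=\beta^{-1}$, and let $1\le j_1<\dots<j_r\le n-1$. If $j_k\le j_{k+1}-2$ for all $k=1,\dots,r-1$, then \[\mathbb{P}\big(S_{n,\alpha,\beta}(j_1)=\dots=S_{n,\alpha,\beta}(j_r)=\alpha\big)=\prod_{k=1}^{r}\frac{b+j_{r-k+1}-2r+2k-1}{(a+b+n-2r+2k-1)(a+b+n-2r+2k-2)}.\] Otherwise, $\mathbb{P}\big(S_{n,\alpha,\beta}(j_1)=\dots=S_{n,\alpha,\beta}(j_r)=\alpha\big)=0$.
   Context: A staircase tableau of size $n$ is a Young diagram of shape $(n,n-1,\dots,1)$ (row $i$ has boxes $(i,j)$, $1\le j\le n-i+1$; rows numbered top to bottom, columns left to right) whose boxes are empty or contain a symbol, such that: all boxes in the same column and above an $\alpha$ are empty; all boxes in the same row and to the left of a $\beta$ are empty; every box $(i,j)$ with $i+j=n+1$ (main diagonal) contains a symbol. An $\alpha/\beta$-staircase tableau uses only the symbols $\alpha,\beta$; its weight is $\alpha^{N_\alpha}\beta^{N_\beta}$ ($N_\alpha,N_\beta$ the numbers of $\alpha$'s and $\beta$'s). $S_{n,\alpha,\beta}$ is the random $\alpha/\beta$-staircase tableau of size $n$ with $\mathbb{P}(S_{n,\alpha,\beta}=S)=wt(S)/\sum_{S'}wt(S')$. The second main diagonal consists of the boxes $(n-i,i)$, $i=1,\dots,n-1$, and $S_{n,\alpha,\beta}(i)$ denotes the content of box $(n-i,i)$. *)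

theory Defs
  imports "HOL-Probability.Probability"
begin

datatype symbol = Alpha | Beta

definition staircase :: "nat \<Rightarrow> (nat \<times> nat) set" where
  "staircase n = {(i, j). 1 \<le> i \<and> 1 \<le> j \<and> i + j \<le> n + 1}"

text \<open>
  A filling is a partial map on boxes \<open>(row, column)\<close>, undefined on empty boxes.  It is
  undefined outside the diagram as well, so that distinct maps are distinct tableaux.
\<close>

type_synonym filling = "nat \<times> nat \<rightharpoonup> symbol"

definition staircase_tableaux :: "nat \<Rightarrow> filling set" where
  "staircase_tableaux n = {T.
     dom T \<subseteq> staircase n \<and>
     (\<forall>i j. T (i, j) = Some Alpha \<longrightarrow> (\<forall>i'<i. T (i', j) = None)) \<and>
     (\<forall>i j. T (i, j) = Some Beta \<longrightarrow> (\<forall>j'<j. T (i, j') = None)) \<and>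
     (\<forall>(i, j) \<in> staircase n. i + j = n + 1 \<longrightarrow> T (i, j) \<noteq> None)}"

definition wt :: "real \<Rightarrow> real \<Rightarrow> filling \<Rightarrow> real" where
  "wt \<alpha> \<beta> T = \<alpha> ^ card {x. T x = Some Alpha} * \<beta> ^ card {x. T x = Some Beta}"

text \<open>
  The function given to \<^const>\<open>embed_pmf\<close> is a probability mass function for
  \<open>\<alpha>, \<beta> > 0\<close>; see lemma \<open>pmf_random_tableau\<close> below.
\<close>

definition random_tableau :: "nat \<Rightarrow> real \<Rightarrow> real \<Rightarrow> filling pmf" where
  "random_tableau n \<alpha> \<beta> = embed_pmf (\<lambda>T.
     if T \<in> staircase_tableaux n
     then wt \<alpha> \<beta> T / (\<Sum>T' \<in> staircase_tableaux n. wt \<alpha> \<beta> T') else 0)"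

definition second_diag :: "nat \<Rightarrow> filling \<Rightarrow> nat \<Rightarrow> symbol option" where
  "second_diag n T i = T (n - i, i)"

lemma finite_staircase: "finite (staircase n)"
  by (rule finite_subset[of _ "{..n + 1} \<times> {..n + 1}"]) (auto simp: staircase_def)

lemma finite_staircase_tableaux: "finite (staircase_tableaux n)"
proof -
  have "finite (UNIV :: symbol set)"
    by (rule finite_subset[of _ "{Alpha, Beta}"]) (auto intro: symbol.exhaust)
  then have "finite {T :: filling. dom T = D \<and> ran T \<subseteq> UNIV}" if "D \<subseteq> staircase n" for D
    using that finite_staircase finite_subset finite_set_of_finite_maps by blast
  then have "finite (\<Union>D \<in> Pow (staircase n). {T :: filling. dom T = D \<and> ran T \<subseteq> UNIV})"
    using finite_staircase by auto
  then show ?thesis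
    by (rule rev_finite_subset) (auto simp: staircase_tableaux_def)
qed

lemma staircase_tableaux_nonempty: "staircase_tableaux n \<noteq> {}"
proof -
  have "(\<lambda>(i, j). if 1 \<le> i \<and> 1 \<le> j \<and> i + j = n + 1 then Some Alpha else None)
          \<in> staircase_tableaux n"
    by (auto simp: staircase_tableaux_def staircase_def split: if_splits)
  then show ?thesis by blast
qed

lemma pmf_random_tableau:
  assumes "0 < \<alpha>" and "0 < \<beta>"
  shows "pmf (random_tableau n \<alpha> \<beta>) T =
    (if T \<in> staircase_tableaux n
     then wt \<alpha> \<beta> T / (\<Sum>T' \<in> staircase_tableaux n. wt \<alpha> \<beta> T') else 0)"
proof -
  let ?S = "staircase_tableaux n"
  let ?Z = "\<Sum>T' \<in> ?S. wt \<alpha> \<beta> T'"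
  let ?f = "\<lambda>T. if T \<in> ?S then wt \<alpha> \<beta> T / ?Z else 0"
  have wt_pos: "0 < wt \<alpha> \<beta> T" for T
    using assms by (simp add: wt_def)
  have Z_pos: "0 < ?Z"
    by (intro sum_pos finite_staircase_tableaux staircase_tableaux_nonempty wt_pos)
  have nonneg: "0 \<le> ?f T" for T
    using wt_pos[of T] Z_pos by simp
  have "(\<integral>\<^sup>+T. ennreal (?f T) \<partial>count_space UNIV) = (\<Sum>T \<in> ?S. ennreal (?f T))"
    by (rule nn_integral_count_space'[OF finite_staircase_tableaux]) auto
  also have "\<dots> = ennreal (\<Sum>T \<in> ?S. ?f T)"
    by (intro sum_ennreal nonneg)
  also have "(\<Sum>T \<in> ?S. ?f T) = (\<Sum>T \<in> ?S. wt \<alpha> \<beta> T) / ?Z"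
    unfolding sum_divide_distrib by (rule sum.cong) auto
  also have "\<dots> = 1"
    using Z_pos by simp
  finally show ?thesis
    unfolding random_tableau_def by (subst pmf_embed_pmf[OF nonneg]) auto
qed

end

theory Submission
  imports Defs
begin

text \<open>
  A tableau of size \<open>n + 1\<close> arises from one of size \<open>n\<close> by prepending a column whose symbols
  lie in the new bottom row or in rows without \<open>\<beta>\<close>.  If there are \<open>k\<close> rows without \<open>\<beta>\<close>, these
  columns have total weight \<open>(\<alpha> + \<beta>) (1 + \<beta>)^k\<close>, and \<open>k\<close> is \<open>n\<close> minus the number of \<open>\<beta>\<close>'s, so
  deleting the first column of a random tableau gives a random tableau with \<open>\<beta>\<close> replaced by
  \<open>\<beta> / (1 + \<beta>)\<close>, that is, \<open>b\<close> by \<open>b + 1\<close>.  Deleting \<open>j\<^sub>1 - 1\<close> columns moves the box of \<open>j\<^sub>1\<close> to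
  the first column.  An \<open>\<alpha>\<close> there determines the first two columns (an \<open>\<alpha>\<close> above a \<open>\<beta>\<close>, then a
  diagonal \<open>\<alpha>\<close>), which contribute \<open>\<alpha>\<^sup>2 \<beta>\<close> and leave an arbitrary tableau of size smaller
  by 2; the formula follows by induction on \<open>r\<close>.  If \<open>j\<^sub>k\<^sub>+\<^sub>1 = j\<^sub>k + 1\<close>, the diagonal box right of one
  \<open>\<alpha>\<close> and below the other can hold neither symbol.
\<close>

section \<open>Removing and prepending columns\<close>

definition drop_columns :: "nat \<Rightarrow> filling \<Rightarrow> filling" where
  "drop_columns m T = (\<lambda>(i, j). if j = 0 then None else T (i, j + m))"

text \<open>Column 0 lies outside the diagram and is cleared explicitly here and in
  \<open>drop_columns\<close>, where the shift would otherwise move column \<open>m\<close> into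
  it.\<close>

definition add_column :: "(nat \<rightharpoonup> symbol) \<Rightarrow> filling \<Rightarrow> filling" where
  "add_column c T = (\<lambda>(i, j). if j = 0 then None else if j = 1 then c i else T (i, j - 1))"

text \<open>Only the rule for \<alpha> acts within a single column. The rule for \<beta> compares
  boxes of a row and enters through the choice of \<open>F\<close>.\<close>

definition columns :: "nat set \<Rightarrow> (nat \<rightharpoonup> symbol) set" where
  "columns F = {c. dom c \<subseteq> F \<and> (\<forall>i. c i = Some Alpha \<longrightarrow> (\<forall>i'<i. c i' = None))}"

definition column_wt :: "real \<Rightarrow> real \<Rightarrow> (nat \<rightharpoonup> symbol) \<Rightarrow> real" where
  "column_wt \<alpha> \<beta> c = \<alpha> ^ card {i. c i = Some Alpha} * \<beta> ^ card {i. c i = Some Beta}"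

definition free_rows :: "nat \<Rightarrow> filling \<Rightarrow> nat set" where
  "free_rows n T = {i \<in> {1..n}. \<forall>j. T (i, j) \<noteq> Some Beta}"

text \<open>These are the columns that can stand to the left of \<open>T\<close>: row
  \<open>Suc n\<close> is the new row, whose only box is on the main diagonal and hence
  filled.\<close>

definition first_columns :: "nat \<Rightarrow> filling \<Rightarrow> (nat \<rightharpoonup> symbol) set" where
  "first_columns n T = {c \<in> columns (insert (Suc n) (free_rows n T)). c (Suc n) \<noteq> None}"

lemma not_None_symbol: "x \<noteq> None \<longleftrightarrow> x = Some Alpha \<or> x = Some Beta"
  by (metis not_None_eq symbol.exhaust)

section \<open>Total weight of the fillings of one column\<close>

lemma finite_columns:
  assumes "finite F"
  shows "finite (columns F)"
proof -
  have "finite (UNIV :: symbol set)"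
    by (rule finite_subset[of _ "{Alpha, Beta}"]) (auto intro: symbol.exhaust)
  then have "finite {c :: nat \<rightharpoonup> symbol. dom c = D \<and> ran c \<subseteq> UNIV}" if "D \<subseteq> F" for D
    using that assms finite_subset finite_set_of_finite_maps by blast
  then have "finite (\<Union>D \<in> Pow F. {c :: nat \<rightharpoonup> symbol. dom c = D \<and> ran c \<subseteq> UNIV})"
    using assms by auto
  then show ?thesis
    by (rule rev_finite_subset) (auto simp: columns_def)
qed

lemma columns_empty: "columns {} = {Map.empty}"
  by (auto simp: columns_def)

lemma columns_insert_None:
  assumes "\<forall>i\<in>F. i < m"
  shows "{c \<in> columns (insert m F). c m = None} = columns F"
proof -
  have "m \<notin> F" using assms by blast
  then have iff: "dom c \<subseteq> insert m F \<and> c m = None \<longleftrightarrow> dom c \<subseteq> F" for c :: "nat \<rightharpoonup> symbol"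
    by (metis domIff insert_iff subset_insert subset_eq)
  show ?thesis
    unfolding columns_def mem_Collect_eq using iff by (intro Collect_cong) metis
qed

text \<open>Row \<open>m\<close> is the lowest. An \<alpha> there empties all boxes above it, while
  a \<beta> puts no constraint on the rest of the column.\<close>

lemma columns_insert_Some:
  assumes "\<forall>i\<in>F. i < m"
  shows "{c \<in> columns (insert m F). c m \<noteq> None}
    = insert [m \<mapsto> Alpha] ((\<lambda>c. c(m \<mapsto> Beta)) ` columns F)" (is "?L = ?R")
proof
  show "?L \<subseteq> ?R"
  proof
    fix c assume c: "c \<in> ?L"
    then have dom: "dom c \<subseteq> insert m F" and al: "\<And>i i'. c i = Some Alpha \<Longrightarrow> i' < i \<Longrightarrow> c i' = None"
      by (auto simp: columns_def)
    from c consider "c m = Some Alpha" | "c m = Some Beta"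
      using not_None_symbol[of "c m"] by blast
    then show "c \<in> ?R"
    proof cases
      case 1
      have "c i = None" if "i \<noteq> m" for i
      proof (cases "i < m")
        case True
        then show ?thesis using al[OF 1] by blast
      next
        case False
        then have "i \<notin> insert m F" using that assms by blast
        then show ?thesis using dom by blast
      qed
      then have "c = [m \<mapsto> Alpha]" using 1 by auto
      then show ?thesis by simp
    next
      case 2
      have "dom (c(m := None)) \<subseteq> F" using dom by auto
      moreover have "(c(m := None)) i' = None" if "(c(m := None)) i = Some Alpha" "i' < i" for i i'
        using that al[of i i'] by (simp split: if_splits)
      ultimately have "c(m := None) \<in> columns F" unfolding columns_def by blast
      moreover have "c = (c(m := None))(m \<mapsto> Beta)" using 2 by (simp add: fun_upd_idem)
      ultimately show ?thesis by blast
    qed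
  qed
  show "?R \<subseteq> ?L"
  proof
    fix c assume "c \<in> ?R"
    then consider "c = [m \<mapsto> Alpha]" | d where "d \<in> columns F" "c = d(m \<mapsto> Beta)"
      by blast
    then show "c \<in> ?L"
    proof cases
      case 1
      then show ?thesis by (simp add: columns_def)
    next
      case 2
      then have d: "dom d \<subseteq> F" "\<And>i i'. d i = Some Alpha \<Longrightarrow> i' < i \<Longrightarrow> d i' = None"
        by (auto simp only: columns_def mem_Collect_eq)
      have "c i' = None" if "c i = Some Alpha" "i' < i" for i i'
      proof -
        have "i \<noteq> m" and di: "d i = Some Alpha" using that 2(2) by (auto split: if_splits)
        moreover have "i < m" using di d(1) assms by blast
        ultimately show ?thesis using that d(2)[OF di] 2(2) by simp
      qed
      then show ?thesis using d(1) 2(2) by (auto simp add: columns_def)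
    qed
  qed
qed

lemma column_wt_single: "column_wt \<alpha> \<beta> [m \<mapsto> Alpha] = \<alpha>"
proof -
  have "{i. [m \<mapsto> Alpha] i = Some Alpha} = {m}" "{i. [m \<mapsto> Alpha] i = Some Beta} = {}"
    by (auto split: if_splits)
  then show ?thesis by (simp add: column_wt_def)
qed

lemma column_wt_upd_Beta:
  assumes "finite (dom c)" "c m = None"
  shows "column_wt \<alpha> \<beta> (c(m \<mapsto> Beta)) = \<beta> * column_wt \<alpha> \<beta> c"
proof -
  have 1: "{i. (c(m \<mapsto> Beta)) i = Some Alpha} = {i. c i = Some Alpha}"
    using assms by (auto split: if_splits)
  have 2: "{i. (c(m \<mapsto> Beta)) i = Some Beta} = insert m {i. c i = Some Beta}"
    by auto
  have "finite {i. c i = Some Beta}"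
    using assms(1) by (rule rev_finite_subset) auto
  then show ?thesis unfolding column_wt_def 1 2 using assms(2) by simp
qed

lemma sum_columns_insert_Some:
  assumes "finite F" "\<forall>i\<in>F. i < m"
  shows "(\<Sum>c \<in> {c \<in> columns (insert m F). c m \<noteq> None}. column_wt \<alpha> \<beta> c)
    = \<alpha> + \<beta> * (\<Sum>c \<in> columns F. column_wt \<alpha> \<beta> c)"
proof -
  have None: "c m = None" if "c \<in> columns F" for c
    using that assms by (auto simp: columns_def dom_def)
  have inj: "inj_on (\<lambda>c. c(m \<mapsto> Beta)) (columns F)"
    by (rule inj_onI) (metis None fun_upd_triv fun_upd_upd)
  have "[m \<mapsto> Alpha] \<notin> (\<lambda>c. c(m \<mapsto> Beta)) ` columns F"
    by (auto dest!: fun_cong[where x = m])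
  then have "(\<Sum>c \<in> {c \<in> columns (insert m F). c m \<noteq> None}. column_wt \<alpha> \<beta> c)
    = \<alpha> + (\<Sum>c \<in> (\<lambda>c. c(m \<mapsto> Beta)) ` columns F. column_wt \<alpha> \<beta> c)"
    using finite_columns[OF assms(1)]
    by (simp add: columns_insert_Some[OF assms(2)] column_wt_single
        del: fun_upd_apply not_None_eq)
  also have "(\<Sum>c \<in> (\<lambda>c. c(m \<mapsto> Beta)) ` columns F. column_wt \<alpha> \<beta> c)
    = (\<Sum>c \<in> columns F. \<beta> * column_wt \<alpha> \<beta> c)"
    unfolding sum.reindex[OF inj] comp_def
  proof (rule sum.cong[OF refl])
    fix c assume c: "c \<in> columns F"
    then have "finite (dom c)" using assms(1) by (auto simp: columns_def intro: finite_subset)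
    then show "column_wt \<alpha> \<beta> (c(m \<mapsto> Beta)) = \<beta> * column_wt \<alpha> \<beta> c"
      using None[OF c] by (rule column_wt_upd_Beta)
  qed
  finally show ?thesis by (simp add: sum_distrib_left)
qed

text \<open>By \<open>sum_columns_insert_Some\<close> the left side is the weight of all columns
  with one more row below \<open>F\<close> whose box is filled. In this form the recursion is a
  plain multiplication: a new lowest row replaces the sum \<open>s\<close> by
  \<open>s + (\<alpha> + \<beta> * s)\<close>, which multiplies
  \<open>\<alpha> + \<beta> * s\<close> by \<open>1 + \<beta>\<close>.\<close>

lemma sum_columns:
  assumes "finite F"
  shows "\<alpha> + \<beta> * (\<Sum>c \<in> columns F. column_wt \<alpha> \<beta> c) = (\<alpha> + \<beta>) * (1 + \<beta>) ^ card F"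
  using assms
proof (induction F rule: finite_linorder_max_induct)
  case empty
  then show ?case by (simp add: columns_empty column_wt_def)
next
  case (insert m F)
  let ?C = "columns (insert m F)"
  let ?s = "\<Sum>c \<in> columns F. column_wt \<alpha> \<beta> c"
  have fin: "finite ?C" using insert.hyps by (simp add: finite_columns)
  have "?C = {c \<in> ?C. c m = None} \<union> {c \<in> ?C. c m \<noteq> None}" by blast
  then have "(\<Sum>c \<in> ?C. column_wt \<alpha> \<beta> c)
    = (\<Sum>c \<in> {c \<in> ?C. c m = None} \<union> {c \<in> ?C. c m \<noteq> None}. column_wt \<alpha> \<beta> c)" by metis
  also have "\<dots> = (\<Sum>c \<in> {c \<in> ?C. c m = None}. column_wt \<alpha> \<beta> c)
      + (\<Sum>c \<in> {c \<in> ?C. c m \<noteq> None}. column_wt \<alpha> \<beta> c)"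
    using fin by (intro sum.union_disjoint) auto
  also have "\<dots> = ?s + (\<alpha> + \<beta> * ?s)"
    using insert.hyps by (simp only: columns_insert_None sum_columns_insert_Some)
  finally have "\<alpha> + \<beta> * (\<Sum>c \<in> ?C. column_wt \<alpha> \<beta> c) = (1 + \<beta>) * (\<alpha> + \<beta> * ?s)"
    by (simp add: algebra_simps)
  moreover have "m \<notin> F" using insert.hyps by auto
  ultimately show ?case using insert by simp
qed

section \<open>Rules for tableaux, and counting the rows without \<beta>\<close>

lemma staircase_tableaux_dom:
  "T \<in> staircase_tableaux n \<Longrightarrow> T (i, j) \<noteq> None \<Longrightarrow> 1 \<le> i \<and> 1 \<le> j \<and> i + j \<le> n + 1"
proof -
  assume "T \<in> staircase_tableaux n" "T (i, j) \<noteq> None"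
  then have "(i, j) \<in> staircase n"
    unfolding staircase_tableaux_def mem_Collect_eq by (metis domIff subsetD)
  then show ?thesis
    by (simp add: staircase_def)
qed

lemma staircase_tableaux_Alpha:
  "T \<in> staircase_tableaux n \<Longrightarrow> T (i, j) = Some Alpha \<Longrightarrow> i' < i \<Longrightarrow> T (i', j) = None"
  unfolding staircase_tableaux_def mem_Collect_eq by (elim conjE) metis

lemma staircase_tableaux_Beta:
  "T \<in> staircase_tableaux n \<Longrightarrow> T (i, j) = Some Beta \<Longrightarrow> j' < j \<Longrightarrow> T (i, j') = None"
  unfolding staircase_tableaux_def mem_Collect_eq by (elim conjE) metis

lemma staircase_tableaux_diag:
  assumes "T \<in> staircase_tableaux n" "1 \<le> i" "1 \<le> j" "i + j = n + 1"
  shows "T (i, j) \<noteq> None"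
proof -
  have ij: "(i, j) \<in> staircase n" using assms by (simp add: staircase_def)
  have "\<forall>(i, j) \<in> staircase n. i + j = n + 1 \<longrightarrow> T (i, j) \<noteq> None"
    using assms(1) unfolding staircase_tableaux_def mem_Collect_eq by (elim conjE)
  from bspec[OF this ij] show ?thesis
    unfolding prod.case using assms(4) by (rule mp)
qed

lemma staircase_tableaux_column_0: "T \<in> staircase_tableaux n \<Longrightarrow> T (i, 0) = None"
  using staircase_tableaux_dom[of T n i 0] by linarith

lemma staircase_tableaux_row_Suc: "T \<in> staircase_tableaux n \<Longrightarrow> T (Suc n, j) = None"
  using staircase_tableaux_dom[of T n "Suc n" j] by linarith

lemma staircase_tableauxI:
  assumes "\<And>i j. T (i, j) \<noteq> None \<Longrightarrow> 1 \<le> i \<and> 1 \<le> j \<and> i + j \<le> n + 1"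
    and "\<And>i j i'. T (i, j) = Some Alpha \<Longrightarrow> i' < i \<Longrightarrow> T (i', j) = None"
    and "\<And>i j j'. T (i, j) = Some Beta \<Longrightarrow> j' < j \<Longrightarrow> T (i, j') = None"
    and "\<And>i j. 1 \<le> i \<Longrightarrow> 1 \<le> j \<Longrightarrow> i + j = n + 1 \<Longrightarrow> T (i, j) \<noteq> None"
  shows "T \<in> staircase_tableaux n"
  unfolding staircase_tableaux_def mem_Collect_eq
proof (intro conjI)
  show "dom T \<subseteq> staircase n"
    using assms(1) by (auto simp only: staircase_def dom_def mem_Collect_eq)
  show "\<forall>i j. T (i, j) = Some Alpha \<longrightarrow> (\<forall>i'<i. T (i', j) = None)"
    using assms(2) by blast
  show "\<forall>i j. T (i, j) = Some Beta \<longrightarrow> (\<forall>j'<j. T (i, j') = None)"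
    using assms(3) by blast
  show "\<forall>(i, j)\<in>staircase n. i + j = n + 1 \<longrightarrow> T (i, j) \<noteq> None"
    using assms(4) by (auto simp only: staircase_def mem_Collect_eq)
qed

lemma staircase_tableaux_finite_dom: "T \<in> staircase_tableaux n \<Longrightarrow> finite (dom T)"
  unfolding staircase_tableaux_def using finite_subset[OF _ finite_staircase] by blast

text \<open>A row holds at most one \<beta>, since the left one of two would have to be an empty
  box. Hence the rows that are not free are in bijection with the \<beta>'s.\<close>

lemma card_free_rows:
  assumes T: "T \<in> staircase_tableaux n"
  shows "card (free_rows n T) + card {x. T x = Some Beta} = n"
proof -
  let ?B = "{x. T x = Some Beta}"
  note right = staircase_tableaux_Beta[OF T]
  have inj: "inj_on fst ?B"
  proof (rule inj_onI)
    fix x y assume xy: "x \<in> ?B" "y \<in> ?B" "fst x = fst y"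
    obtain i k l where "x = (i, k)" "y = (i, l)" using xy(3) by (cases x; cases y) auto
    then show "x = y" using xy(1,2) right[of i k l] right[of i l k] by (cases k l rule: linorder_cases) auto
  qed
  have "fst ` ?B \<subseteq> {1..n}"
    using staircase_tableaux_dom[OF T] by fastforce
  moreover have "free_rows n T = {1..n} - fst ` ?B"
    by (force simp: free_rows_def)
  moreover have "card (fst ` ?B) \<le> n"
    using calculation(1) card_mono[of "{1..n}"] by fastforce
  ultimately show ?thesis
    using card_image[OF inj] by (simp add: card_Diff_subset finite_subset)
qed

lemma finite_free_rows: "finite (free_rows n T)"
  by (simp add: free_rows_def)

section \<open>Tableaux of size \<open>Suc n\<close> as pairs of a smaller tableau and a first
  column\<close>

lemma add_column_in_staircase_tableaux:
  assumes T: "T \<in> staircase_tableaux n" and c: "c \<in> first_columns n T"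
  shows "add_column c T \<in> staircase_tableaux (Suc n)"
proof -
  note d = staircase_tableaux_dom[OF T]
  have c1: "c i \<noteq> None \<Longrightarrow> i = Suc n \<or> (1 \<le> i \<and> i \<le> n \<and> (\<forall>j. T (i, j) \<noteq> Some Beta))" for i
    using c by (fastforce simp: first_columns_def columns_def free_rows_def dom_def)
  have c2: "c i = Some Alpha \<Longrightarrow> i' < i \<Longrightarrow> c i' = None" for i i'
    using c by (auto simp: first_columns_def columns_def)
  have c3: "c (Suc n) \<noteq> None" using c by (auto simp: first_columns_def)
  note t1 = staircase_tableaux_Alpha[OF T] and t2 = staircase_tableaux_Beta[OF T]
    and t3 = staircase_tableaux_diag[OF T]
  note last = staircase_tableaux_row_Suc[OF T]
  \<comment> \<open>A \<beta> of \<open>T\<close> lies in one of the rows 1 to \<open>n\<close>, as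
    row \<open>Suc n\<close> of \<open>T\<close> is empty; in those rows \<open>c\<close> is
    confined to free ones.\<close>
  have rowc: "c i = None" if "T (i, j) = Some Beta" for i j
    using c1[of i] that last[of j] by (cases "c i") auto
  show ?thesis
  proof (rule staircase_tableauxI)
    fix i j assume "add_column c T (i, j) \<noteq> None"
    then show "1 \<le> i \<and> 1 \<le> j \<and> i + j \<le> Suc n + 1"
      using c1[of i] d[of i "j - 1"] by (auto simp: add_column_def split: if_splits)
  next
    fix i i' j assume "add_column c T (i, j) = Some Alpha" "i' < i"
    then show "add_column c T (i', j) = None"
      using c2[of i i'] t1[of i "j - 1" i'] by (auto simp: add_column_def split: if_splits)
  next
    fix i j j' assume "add_column c T (i, j) = Some Beta" "j' < j"
    then show "add_column c T (i, j') = None"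
      using rowc[of i "j - 1"] t2[of i "j - 1" "j' - 1"] by (auto simp: add_column_def split: if_splits)
  next
    fix i j assume "1 \<le> i" "1 \<le> j" "i + j = Suc n + 1"
    then show "add_column c T (i, j) \<noteq> None"
      using c3 t3[of i "j - 1"] by (cases "j = 1") (auto simp: add_column_def)
  qed
qed

lemma drop_column_in_staircase_tableaux:
  assumes T: "T \<in> staircase_tableaux (Suc n)"
  shows "drop_columns 1 T \<in> staircase_tableaux n"
proof -
  note D = staircase_tableaux_dom[OF T] staircase_tableaux_Alpha[OF T]
    staircase_tableaux_Beta[OF T] staircase_tableaux_diag[OF T]
  show ?thesis
  proof (rule staircase_tableauxI)
    fix i j assume "drop_columns 1 T (i, j) \<noteq> None"
    then show "1 \<le> i \<and> 1 \<le> j \<and> i + j \<le> n + 1"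
      using D(1)[of i "Suc j"] by (auto simp: drop_columns_def split: if_splits)
  next
    fix i i' j assume "drop_columns 1 T (i, j) = Some Alpha" "i' < i"
    then show "drop_columns 1 T (i', j) = None"
      using D(2)[of i "Suc j" i'] by (auto simp: drop_columns_def split: if_splits)
  next
    fix i j j' assume "drop_columns 1 T (i, j) = Some Beta" "j' < j"
    then show "drop_columns 1 T (i, j') = None"
      using D(3)[of i "Suc j" "Suc j'"] by (auto simp: drop_columns_def split: if_splits)
  next
    fix i j assume "1 \<le> i" "1 \<le> j" "i + j = n + 1"
    then show "drop_columns 1 T (i, j) \<noteq> None"
      using D(4)[of i "Suc j"] by (auto simp: drop_columns_def)
  qed
qed

text \<open>A symbol in column 1 excludes any \<beta> further right in its row, so the row is free
  once column 1 is gone.\<close>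

lemma first_column_in_first_columns:
  assumes T: "T \<in> staircase_tableaux (Suc n)"
  shows "(\<lambda>i. T (i, 1)) \<in> first_columns n (drop_columns 1 T)"
proof -
  have "i = Suc n \<or> i \<in> free_rows n (drop_columns 1 T)" if "T (i, 1) \<noteq> None" for i
  proof -
    have "1 \<le> i \<and> i \<le> Suc n" using staircase_tableaux_dom[OF T that] by simp
    moreover have "T (i, Suc j) \<noteq> Some Beta" if "j > 0" for j
      using staircase_tableaux_Beta[OF T, of i "Suc j" 1] \<open>T (i, 1) \<noteq> None\<close> that by auto
    ultimately show ?thesis
      by (auto simp: free_rows_def drop_columns_def)
  qed
  then have "dom (\<lambda>i. T (i, 1)) \<subseteq> insert (Suc n) (free_rows n (drop_columns 1 T))"
    by blast
  then show ?thesis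
    using staircase_tableaux_Alpha[OF T] staircase_tableaux_diag[OF T, of "Suc n" 1]
    by (simp add: first_columns_def columns_def)
qed

lemma add_column_drop_columns:
  assumes T: "T \<in> staircase_tableaux n"
  shows "add_column (\<lambda>i. T (i, 1)) (drop_columns 1 T) = T"
  by (rule ext) (auto simp: add_column_def drop_columns_def staircase_tableaux_column_0[OF T])

lemma drop_columns_add_column:
  assumes T: "T \<in> staircase_tableaux n"
  shows "drop_columns 1 (add_column c T) = T"
  by (rule ext) (auto simp: add_column_def drop_columns_def staircase_tableaux_column_0[OF T])

text \<open>Reading off the first column and dropping it is inverse to \<open>add_column\<close>.
  All later weight computations peel off columns through this identity.\<close>

lemma sum_staircase_tableaux_Suc:
  "(\<Sum>T \<in> staircase_tableaux (Suc n). f T)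
    = (\<Sum>T \<in> staircase_tableaux n. \<Sum>c \<in> first_columns n T. f (add_column c T))"
proof -
  have fin: "finite (first_columns n T)" for T
    using finite_columns[of "insert (Suc n) (free_rows n T)"] finite_free_rows
    by (simp add: first_columns_def)
  have "(\<Sum>T \<in> staircase_tableaux n. \<Sum>c \<in> first_columns n T. f (add_column c T))
    = (\<Sum>(T, c) \<in> Sigma (staircase_tableaux n) (first_columns n). f (add_column c T))"
    using fin finite_staircase_tableaux by (simp add: sum.Sigma)
  also have "\<dots> = (\<Sum>T \<in> staircase_tableaux (Suc n). f T)"
  proof (rule sum.reindex_bij_witness[where
        i = "\<lambda>T. (drop_columns 1 T, \<lambda>i. T (i, 1))" and j = "\<lambda>(T, c). add_column c T"])
    fix x assume "x \<in> Sigma (staircase_tableaux n) (first_columns n)"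
    then obtain T c where x: "x = (T, c)" and T: "T \<in> staircase_tableaux n"
      and c: "c \<in> first_columns n T" by blast
    show "(drop_columns 1 (case x of (T, c) \<Rightarrow> add_column c T),
        \<lambda>i. (case x of (T, c) \<Rightarrow> add_column c T) (i, 1)) = x"
      unfolding x prod.case drop_columns_add_column[OF T] by (simp add: add_column_def)
    show "(case x of (T, c) \<Rightarrow> add_column c T) \<in> staircase_tableaux (Suc n)"
      unfolding x prod.case by (rule add_column_in_staircase_tableaux[OF T c])
    show "f (case x of (T, c) \<Rightarrow> add_column c T) = (case x of (T, c) \<Rightarrow> f (add_column c T))"
      unfolding x prod.case ..
  next
    fix T assume T: "T \<in> staircase_tableaux (Suc n)"
    show "(case (drop_columns 1 T, \<lambda>i. T (i, 1)) of (T, c) \<Rightarrow> add_column c T) = T"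
      unfolding prod.case by (rule add_column_drop_columns[OF T])
    show "(drop_columns 1 T, \<lambda>i. T (i, 1)) \<in> Sigma (staircase_tableaux n) (first_columns n)"
      by (intro SigmaI drop_column_in_staircase_tableaux first_column_in_first_columns T)
  qed
  finally show ?thesis by simp
qed

section \<open>Weights when a column is prepended or dropped\<close>

lemma card_add_column:
  assumes "finite (dom T)" "finite (dom c)" "\<And>i. T (i, 0) = None"
  shows "card {x. add_column c T x = Some s} = card {i. c i = Some s} + card {x. T x = Some s}"
proof -
  let ?f = "\<lambda>i. (i, 1 :: nat)" and ?g = "\<lambda>(i :: nat, j). (i, Suc j)"
  have eq: "{x. add_column c T x = Some s} = ?f ` {i. c i = Some s} \<union> ?g ` {x. T x = Some s}"
    (is "?L = ?R")
  proof
    show "?L \<subseteq> ?R"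
    proof clarify
      fix i j assume h: "add_column c T (i, j) = Some s" "(i, j) \<notin> ?g ` {x. T x = Some s}"
      show "(i, j) \<in> ?f ` {i. c i = Some s}"
      proof (cases "j \<le> 1")
        case True
        then show ?thesis using h(1) by (auto simp: add_column_def split: if_splits)
      next
        case False
        then have "T (i, j - 1) = Some s" using h(1) by (auto simp: add_column_def)
        then have "?g (i, j - 1) \<in> ?g ` {x. T x = Some s}" by blast
        then show ?thesis using h(2) False by simp
      qed
    qed
    show "?R \<subseteq> ?L" using assms(3) by (auto simp: add_column_def)
  qed
  have "finite {i. c i = Some s}" "finite {x. T x = Some s}"
    using assms(1,2) by (auto intro: rev_finite_subset)
  \<comment> \<open>\<open>?g\<close> sends column 0 to column 1, where \<open>c\<close> sits, so
    disjointness rests on column 0 of \<open>T\<close> being empty.\<close>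
  moreover have "?f ` {i. c i = Some s} \<inter> ?g ` {x. T x = Some s} = {}"
    using assms(3) by auto
  moreover have "card (?f ` {i. c i = Some s}) = card {i. c i = Some s}"
    "card (?g ` {x. T x = Some s}) = card {x. T x = Some s}"
    by (auto intro!: card_image simp: inj_on_def)
  ultimately show ?thesis
    unfolding eq by (simp add: card_Un_disjoint)
qed

lemma wt_add_column:
  assumes T: "T \<in> staircase_tableaux n" and c: "c \<in> first_columns n T"
  shows "wt \<alpha> \<beta> (add_column c T) = column_wt \<alpha> \<beta> c * wt \<alpha> \<beta> T"
proof -
  have "finite (dom c)"
    using c finite_free_rows by (auto simp: first_columns_def columns_def intro: finite_subset)
  moreover note staircase_tableaux_column_0[OF T]
  ultimately show ?thesis
    using staircase_tableaux_finite_dom[OF T]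
    by (simp add: wt_def column_wt_def card_add_column power_add)
qed

text \<open>The event sees only what remains after the drop, so for fixed \<open>T\<close> the sum
  over first columns factors out as a power of \<open>1 + \<beta>\<close>.\<close>

lemma sum_drop_column:
  assumes "\<beta> > 0"
  shows "(\<Sum>T \<in> staircase_tableaux (Suc n). of_bool (P (drop_columns 1 T)) * wt \<alpha> \<beta> T)
    = (\<alpha> + \<beta>) * (1 + \<beta>) ^ n
      * (\<Sum>T \<in> staircase_tableaux n. of_bool (P T) * wt \<alpha> (\<beta> / (1 + \<beta>)) T)"
  unfolding sum_staircase_tableaux_Suc sum_distrib_left
proof (rule sum.cong[OF refl])
  fix T assume T: "T \<in> staircase_tableaux n"
  let ?k = "card (free_rows n T)" and ?m = "card {x. T x = Some Beta}"
  have "(\<Sum>c \<in> first_columns n T. of_bool (P (drop_columns 1 (add_column c T))) * wt \<alpha> \<beta> (add_column c T))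
    = (\<Sum>c \<in> first_columns n T. column_wt \<alpha> \<beta> c) * (of_bool (P T) * wt \<alpha> \<beta> T)"
    unfolding sum_distrib_right
    by (intro sum.cong refl) (simp only: drop_columns_add_column[OF T] wt_add_column[OF T] mult.left_commute)
  also have "(\<Sum>c \<in> first_columns n T. column_wt \<alpha> \<beta> c) = (\<alpha> + \<beta>) * (1 + \<beta>) ^ ?k"
    unfolding first_columns_def sum_columns[OF finite_free_rows, symmetric]
    by (rule sum_columns_insert_Some[OF finite_free_rows]) (auto simp: free_rows_def)
  also have "(\<alpha> + \<beta>) * (1 + \<beta>) ^ ?k * (of_bool (P T) * wt \<alpha> \<beta> T)
    = (\<alpha> + \<beta>) * (1 + \<beta>) ^ n * (of_bool (P T) * wt \<alpha> (\<beta> / (1 + \<beta>)) T)"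
  proof -
    \<comment> \<open>The exponent \<open>?k\<close> varies with \<open>T\<close>. Writing it as
      \<open>n - ?m\<close> leaves a constant power, and the \<open>?m\<close> inverse factors are
      absorbed by the \<beta>'s of the weight.\<close>
    have "(1 + \<beta>) ^ n = (1 + \<beta>) ^ ?k * (1 + \<beta>) ^ ?m"
      using card_free_rows[OF T] by (metis power_add)
    moreover have "1 + \<beta> \<noteq> 0" using assms by simp
    ultimately show ?thesis by (simp add: wt_def power_divide)
  qed
  finally show "(\<Sum>c \<in> first_columns n T. of_bool (P (drop_columns 1 (add_column c T)))
      * wt \<alpha> \<beta> (add_column c T))
    = (\<alpha> + \<beta>) * (1 + \<beta>) ^ n * (of_bool (P T) * wt \<alpha> (\<beta> / (1 + \<beta>)) T)" .
qed

lemma staircase_tableaux_0: "staircase_tableaux 0 = {Map.empty}"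
proof -
  have "T = Map.empty" if T: "T \<in> staircase_tableaux 0" for T
  proof
    fix x :: "nat \<times> nat"
    show "T x = None"
      using staircase_tableaux_dom[OF T, of "fst x" "snd x"] by (cases "T x") auto
  qed
  then show ?thesis
    using staircase_tableaux_nonempty[of 0] by blast
qed

text \<open>Factor \<open>i\<close> is \<open>\<alpha> * \<beta> * (a + b + i)\<close> with
  \<open>a\<close>, \<open>b\<close> the inverses of \<alpha>, \<beta>. Passing to
  \<open>\<beta> / (1 + \<beta>)\<close> and multiplying by \<open>1 + \<beta>\<close> turns factor
  \<open>i\<close> into factor \<open>i + 1\<close>; the factor \<open>\<alpha> + \<beta>\<close>
  from the dropped column supplies the one for \<open>i = 0\<close>.\<close>

lemma sum_wt:
  assumes "\<beta> > 0"
  shows "(\<Sum>T \<in> staircase_tableaux n. wt \<alpha> \<beta> T) = (\<Prod>i<n. \<alpha> + \<beta> + real i * \<alpha> * \<beta>)"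
  using assms
proof (induction n arbitrary: \<beta>)
  case 0
  then show ?case by (simp add: staircase_tableaux_0 wt_def)
next
  case (Suc n)
  have "(1 + \<beta>) ^ n * (\<Prod>i<n. \<alpha> + \<beta> / (1 + \<beta>) + real i * \<alpha> * (\<beta> / (1 + \<beta>)))
    = (\<Prod>i<n. (1 + \<beta>) * (\<alpha> + \<beta> / (1 + \<beta>) + real i * \<alpha> * (\<beta> / (1 + \<beta>))))"
    by (simp add: prod.distrib)
  also have "\<dots> = (\<Prod>i<n. \<alpha> + \<beta> + real (Suc i) * \<alpha> * \<beta>)"
  proof (rule prod.cong[OF refl])
    fix i
    define q where "q = \<beta> / (1 + \<beta>)"
    have q: "(1 + \<beta>) * q = \<beta>" using Suc.prems by (simp add: q_def)
    have "(1 + \<beta>) * (\<alpha> + q + real i * \<alpha> * q)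
      = (1 + \<beta>) * \<alpha> + (1 + real i * \<alpha>) * ((1 + \<beta>) * q)"
      by (simp add: algebra_simps)
    then show "(1 + \<beta>) * (\<alpha> + \<beta> / (1 + \<beta>) + real i * \<alpha> * (\<beta> / (1 + \<beta>)))
      = \<alpha> + \<beta> + real (Suc i) * \<alpha> * \<beta>"
      unfolding q_def[symmetric] q by (simp add: algebra_simps)
  qed
  finally show ?case
    using sum_drop_column[OF Suc.prems, of "\<lambda>_. True" \<alpha> n] Suc.IH[of "\<beta> / (1 + \<beta>)"] Suc.prems
    by (simp add: prod.lessThan_Suc_shift del: prod.lessThan_Suc)
qed

section \<open>From weights to probabilities\<close>

lemma prob_random_tableau:
  assumes "0 < \<alpha>" and "0 < \<beta>"
  shows "measure_pmf.prob (random_tableau n \<alpha> \<beta>) {T. P T}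
    = (\<Sum>T \<in> staircase_tableaux n. of_bool (P T) * wt \<alpha> \<beta> T) / (\<Sum>T \<in> staircase_tableaux n. wt \<alpha> \<beta> T)"
proof -
  let ?S = "staircase_tableaux n" and ?p = "random_tableau n \<alpha> \<beta>"
  have sub: "set_pmf ?p \<subseteq> ?S"
    by (auto simp: set_pmf_eq pmf_random_tableau[OF assms])
  have "measure_pmf.prob ?p {T. P T} = measure_pmf.prob ?p {T \<in> ?S. P T}"
    using sub by (intro measure_pmf.finite_measure_eq_AE) (auto simp: AE_measure_pmf_iff)
  also have "\<dots> = (\<Sum>T \<in> {T \<in> ?S. P T}. wt \<alpha> \<beta> T / (\<Sum>T \<in> ?S. wt \<alpha> \<beta> T))"
    using finite_staircase_tableaux
    by (simp add: measure_measure_pmf_finite pmf_random_tableau[OF assms])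
  also have "\<dots> = (\<Sum>T \<in> ?S. of_bool (P T) * (wt \<alpha> \<beta> T / (\<Sum>T \<in> ?S. wt \<alpha> \<beta> T)))"
    using finite_staircase_tableaux by (intro sum.mono_neutral_cong_left) auto
  finally show ?thesis by (simp add: sum_divide_distrib)
qed

text \<open>In terms of \<open>b\<close>, the passage from \<beta> to
  \<open>\<beta> / (1 + \<beta>)\<close> is the shift to \<open>b + 1\<close>.\<close>

lemma prob_drop_column:
  assumes "0 < \<alpha>" and "0 < b"
  shows "measure_pmf.prob (random_tableau (Suc n) \<alpha> (inverse b)) {T. P (drop_columns 1 T)}
    = measure_pmf.prob (random_tableau n \<alpha> (inverse (b + 1))) {T. P T}"
proof -
  let ?\<beta> = "inverse b"
  have \<beta>: "?\<beta> > 0" and \<beta>': "?\<beta> / (1 + ?\<beta>) = inverse (b + 1)" "inverse (b + 1) > 0"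
    using assms by (auto simp: field_simps)
  \<comment> \<open>The factor of \<open>sum_drop_column\<close> is thus nonzero and cancels; the
    instance with the constantly true event treats the denominator.\<close>
  have "\<alpha> + ?\<beta> \<noteq> 0" "1 + ?\<beta> \<noteq> 0" using assms(1) \<beta> by linarith+
  then show ?thesis
    unfolding prob_random_tableau[OF assms(1) \<beta>] prob_random_tableau[OF assms(1) \<beta>'(2)]
    using sum_drop_column[OF \<beta>, of P \<alpha> n] sum_drop_column[OF \<beta>, of "\<lambda>_. True" \<alpha> n]
    by (simp add: \<beta>')
qed

lemma drop_columns_0:
  assumes T: "T \<in> staircase_tableaux n"
  shows "drop_columns 0 T = T"
  by (rule ext) (auto simp: drop_columns_def staircase_tableaux_column_0[OF T])

lemma drop_columns_drop_columns: "drop_columns l (drop_columns m T) = drop_columns (l + m) T"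
  by (auto simp: drop_columns_def fun_eq_iff add.assoc)

lemma prob_drop_columns:
  assumes "0 < \<alpha>" and "0 < b"
  shows "measure_pmf.prob (random_tableau (m + n) \<alpha> (inverse b)) {T. P (drop_columns m T)}
    = measure_pmf.prob (random_tableau n \<alpha> (inverse (b + real m))) {T. P T}"
  using assms(2)
proof (induction m arbitrary: b)
  case 0
  then show ?case
    \<comment> \<open>\<open>drop_columns 0\<close> clears column 0, so it is the identity only on
      tableaux; hence the passage to sums over tableaux.\<close>
    using assms(1) by (simp add: prob_random_tableau drop_columns_0 cong: sum.cong)
next
  case (Suc m)
  have "measure_pmf.prob (random_tableau (Suc m + n) \<alpha> (inverse b)) {T. P (drop_columns (Suc m) T)}
    = measure_pmf.prob (random_tableau (m + n) \<alpha> (inverse (b + 1))) {T. P (drop_columns m T)}"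
    using prob_drop_column[OF assms(1) Suc.prems, of "m + n" "\<lambda>T. P (drop_columns m T)"]
    by (simp add: drop_columns_drop_columns)
  then show ?case
    using Suc.IH[of "b + 1"] Suc.prems by (simp add: add.assoc)
qed

section \<open>An \<alpha> in the second-diagonal box of the first column\<close>

lemma first_columns_not_Beta:
  "{c \<in> first_columns n T. c (Suc n) \<noteq> Some Beta} = {[Suc n \<mapsto> Alpha]}"
proof -
  have "\<forall>i\<in>free_rows n T. i < Suc n" by (auto simp: free_rows_def)
  from columns_insert_Some[OF this] show ?thesis
    by (auto simp: first_columns_def)
qed

text \<open>The \<alpha> empties all boxes above it, and the filled box below it cannot hold
  \<alpha>, which would empty row \<open>Suc n\<close>; so it holds \<beta>. Such a column fits
  exactly when row \<open>Suc n\<close> of \<open>T\<close> has no \<beta>.\<close>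

lemma first_columns_Alpha:
  "{c \<in> first_columns (Suc n) T. c (Suc n) = Some Alpha}
    = (if \<forall>j. T (Suc n, j) \<noteq> Some Beta then {[Suc n \<mapsto> Alpha, Suc (Suc n) \<mapsto> Beta]} else {})"
    (is "?L = ?R")
proof (cases "\<forall>j. T (Suc n, j) \<noteq> Some Beta")
  case False
  then show ?thesis
    by (auto simp: first_columns_def columns_def free_rows_def dom_def)
next
  case True
  have "c = [Suc n \<mapsto> Alpha, Suc (Suc n) \<mapsto> Beta]" if c: "c \<in> ?L" for c
  proof
    fix i
    have al: "\<And>i i'. c i = Some Alpha \<Longrightarrow> i' < i \<Longrightarrow> c i' = None" and s: "c (Suc n) = Some Alpha"
      and dom: "c i \<noteq> None \<Longrightarrow> i \<le> Suc (Suc n)" and ne: "c (Suc (Suc n)) \<noteq> None"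
      using c by (auto simp: first_columns_def columns_def free_rows_def dom_def)
    have s2: "c (Suc (Suc n)) = Some Beta"
      using ne not_None_symbol[of "c (Suc (Suc n))"] al[of "Suc (Suc n)" "Suc n"] s by auto
    consider "i < Suc n" | "i = Suc n" | "i = Suc (Suc n)" | "i > Suc (Suc n)" by linarith
    then show "c i = [Suc n \<mapsto> Alpha, Suc (Suc n) \<mapsto> Beta] i"
      using al[OF s, of i] s s2 dom by cases (cases "c i"; auto)+
  qed
  moreover have "[Suc n \<mapsto> Alpha, Suc (Suc n) \<mapsto> Beta] \<in> ?L"
    using True by (auto simp: first_columns_def columns_def free_rows_def split: if_splits)
  ultimately show ?thesis using True by auto
qed

text \<open>The first column is forced and weighs \<open>\<alpha> * \<beta>\<close>. It requires row
  \<open>Suc n\<close> of the rest to be free of \<beta>, which forces a single \<alpha> in the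
  second column and gives the other factor \<alpha>. No condition on the remaining tableau is
  left.\<close>

lemma sum_corner_Alpha:
  "(\<Sum>T \<in> staircase_tableaux (Suc (Suc n)).
      of_bool (T (Suc n, 1) = Some Alpha \<and> P (drop_columns 2 T)) * wt \<alpha> \<beta> T)
    = \<alpha>\<^sup>2 * \<beta> * (\<Sum>T \<in> staircase_tableaux n. of_bool (P T) * wt \<alpha> \<beta> T)"
proof -
  let ?c = "[Suc n \<mapsto> Alpha, Suc (Suc n) \<mapsto> Beta]"
  let ?Q = "\<lambda>T. \<forall>j. T (Suc n, j) \<noteq> Some Beta"
  have fin: "finite (first_columns m T)" for m T
    using finite_columns[of "insert (Suc m) (free_rows m T)"] finite_free_rows
    by (simp add: first_columns_def)
  have wc: "column_wt \<alpha> \<beta> ?c = \<alpha> * \<beta>"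
    using column_wt_upd_Beta[of "[Suc n \<mapsto> Alpha]" "Suc (Suc n)" \<alpha> \<beta>] column_wt_single by simp
  have "(\<Sum>T \<in> staircase_tableaux (Suc (Suc n)).
      of_bool (T (Suc n, 1) = Some Alpha \<and> P (drop_columns 2 T)) * wt \<alpha> \<beta> T)
    = (\<Sum>T \<in> staircase_tableaux (Suc n). of_bool (?Q T) * of_bool (P (drop_columns 1 T)) * (\<alpha> * \<beta> * wt \<alpha> \<beta> T))"
    unfolding sum_staircase_tableaux_Suc[of _ "Suc n"]
  proof (rule sum.cong[OF refl])
    fix T assume T: "T \<in> staircase_tableaux (Suc n)"
    have d: "drop_columns 2 (add_column c T) = drop_columns 1 T" for c
      using drop_columns_drop_columns[of 1 1 "add_column c T"] drop_columns_add_column[OF T, of c]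
      by (simp add: numeral_2_eq_2)
    have "(\<Sum>c \<in> first_columns (Suc n) T. of_bool (add_column c T (Suc n, 1) = Some Alpha
        \<and> P (drop_columns 2 (add_column c T))) * wt \<alpha> \<beta> (add_column c T))
      = (\<Sum>c \<in> {c \<in> first_columns (Suc n) T. c (Suc n) = Some Alpha}.
          of_bool (P (drop_columns 1 T)) * (column_wt \<alpha> \<beta> c * wt \<alpha> \<beta> T))"
      unfolding d by (rule sum.mono_neutral_cong_right[OF fin])
        (auto simp: wt_add_column[OF T], auto simp: add_column_def)
    also have "\<dots> = of_bool (?Q T) * of_bool (P (drop_columns 1 T)) * (\<alpha> * \<beta> * wt \<alpha> \<beta> T)"
      unfolding first_columns_Alpha using wc by simp
    finally show "(\<Sum>c \<in> first_columns (Suc n) T. of_bool (add_column c T (Suc n, 1) = Some Alpha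
        \<and> P (drop_columns 2 (add_column c T))) * wt \<alpha> \<beta> (add_column c T))
      = of_bool (?Q T) * of_bool (P (drop_columns 1 T)) * (\<alpha> * \<beta> * wt \<alpha> \<beta> T)" .
  qed
  also have "\<dots> = (\<Sum>T \<in> staircase_tableaux n. \<alpha>\<^sup>2 * \<beta> * (of_bool (P T) * wt \<alpha> \<beta> T))"
    unfolding sum_staircase_tableaux_Suc[of _ n]
  proof (rule sum.cong[OF refl])
    fix T assume T: "T \<in> staircase_tableaux n"
    note last = staircase_tableaux_row_Suc[OF T]
    \<comment> \<open>Row \<open>Suc n\<close> of a tableau of size \<open>n\<close> is empty, so
      only the second column can violate the condition.\<close>
    have Q: "?Q (add_column c T) \<longleftrightarrow> c (Suc n) \<noteq> Some Beta" for c
      using last by (auto simp: add_column_def)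
    have "(\<Sum>c \<in> first_columns n T. of_bool (?Q (add_column c T))
        * of_bool (P (drop_columns 1 (add_column c T))) * (\<alpha> * \<beta> * wt \<alpha> \<beta> (add_column c T)))
      = (\<Sum>c \<in> {c \<in> first_columns n T. c (Suc n) \<noteq> Some Beta}.
          of_bool (P T) * (\<alpha> * \<beta> * (column_wt \<alpha> \<beta> c * wt \<alpha> \<beta> T)))"
      unfolding Q drop_columns_add_column[OF T]
      by (rule sum.mono_neutral_cong_right[OF fin]) (auto simp: wt_add_column[OF T])
    also have "\<dots> = \<alpha>\<^sup>2 * \<beta> * (of_bool (P T) * wt \<alpha> \<beta> T)"
      unfolding first_columns_not_Beta by (simp add: column_wt_single power2_eq_square)
    finally show "(\<Sum>c \<in> first_columns n T. of_bool (?Q (add_column c T))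
        * of_bool (P (drop_columns 1 (add_column c T))) * (\<alpha> * \<beta> * wt \<alpha> \<beta> (add_column c T)))
      = \<alpha>\<^sup>2 * \<beta> * (of_bool (P T) * wt \<alpha> \<beta> T)" .
  qed
  finally show ?thesis by (simp add: sum_distrib_left)
qed

text \<open>The total weights of sizes \<open>n + 2\<close> and \<open>n\<close> differ by the
  factors \<open>n\<close> and \<open>n + 1\<close> of \<open>sum_wt\<close>, each of the form
  \<open>(a + b + i) / (a * b)\<close>; the powers of \<open>a\<close> and \<open>b\<close> reduce
  to a single \<open>b\<close> against \<open>\<alpha>\<^sup>2 * \<beta>\<close>.\<close>

lemma prob_corner_Alpha:
  assumes "0 < a" and "0 < b"
  shows "measure_pmf.prob (random_tableau (Suc (Suc n)) (inverse a) (inverse b))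
      {T. T (Suc n, 1) = Some Alpha \<and> P (drop_columns 2 T)}
    = b / ((a + b + real n + 1) * (a + b + real n))
      * measure_pmf.prob (random_tableau n (inverse a) (inverse b)) {T. P T}"
proof -
  let ?\<alpha> = "inverse a" and ?\<beta> = "inverse b"
  have pos: "?\<alpha> > 0" "?\<beta> > 0" using assms by auto
  let ?Z = "\<Prod>i<n. ?\<alpha> + ?\<beta> + real i * ?\<alpha> * ?\<beta>"
  let ?S = "\<Sum>T \<in> staircase_tableaux n. of_bool (P T) * wt ?\<alpha> ?\<beta> T"
  have e: "?\<alpha> + ?\<beta> + x * ?\<alpha> * ?\<beta> = (a + b + x) / (a * b)" for x
    using assms by (simp add: field_simps)
  have "?\<alpha>\<^sup>2 * ?\<beta> * ?S / (?Z * ((a + b + real n) / (a * b)) * ((a + b + (real n + 1)) / (a * b)))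
    = b / ((a + b + real n + 1) * (a + b + real n)) * (?S / ?Z)"
    using assms by (simp add: divide_simps power2_eq_square)
  then show ?thesis
    unfolding prob_random_tableau[OF pos] sum_wt[OF pos(2)] sum_corner_Alpha
    by (simp add: e add.commute)
qed

section \<open>Induction over the prescribed positions\<close>

lemma second_diag_drop_columns:
  assumes "1 \<le> i"
  shows "second_diag n (drop_columns m T) i = second_diag (n + m) T (i + m)"
  using assms by (simp add: second_diag_def drop_columns_def)

text \<open>The induction removes the leftmost position \<open>j 1\<close>, and generalises over
  \<open>n\<close>, \<open>b\<close> and \<open>j\<close> because dropping columns changes all
  three.\<close>

lemma prob_second_diag_Alpha:
  assumes "0 < a" and "0 < b"
    and "\<forall>k\<in>{1..r}. 1 \<le> j k \<and> j k \<le> n - 1"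
    and "\<forall>k\<in>{1..<r}. j k + 2 \<le> j (k + 1)"
  shows "measure_pmf.prob (random_tableau n (inverse a) (inverse b))
      {T. \<forall>k\<in>{1..r}. second_diag n T (j k) = Some Alpha}
    = (\<Prod>k=1..r. (b + real (j (r - k + 1)) - 2 * real r + 2 * real k - 1) /
        ((a + b + real n - 2 * real r + 2 * real k - 1) *
         (a + b + real n - 2 * real r + 2 * real k - 2)))"
  using assms(2-)
proof (induction r arbitrary: n b j)
  case 0
  then show ?case by simp
next
  case (Suc r)
  \<comment> \<open>\<open>m\<close> columns lie to the left of position \<open>j 1\<close>. After
    these and the two forced columns, \<open>n'\<close> is the remaining size and \<open>j'\<close>
    the remaining positions, shifted by \<open>m + 2 = j 1 + 1\<close>.\<close>
  define m where "m = j 1 - 1"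
  define n' where "n' = n - j 1 - 1"
  define j' where "j' = (\<lambda>k. j (k + 1) - j 1 - 1)"
  have j1: "1 \<le> j 1" "j 1 \<le> n - 1" using Suc.prems(2) by auto
  then have n: "n = m + Suc (Suc n')" and jm: "j 1 = Suc m" by (auto simp: m_def n'_def)
  \<comment> \<open>The gap of 2 after \<open>j 1\<close> keeps every later position beyond the two
    removed columns, so that \<open>j' k\<close> is at least 1.\<close>
  have far: "j 1 + 2 \<le> j (k + 1)" if "k \<in> {1..r}" for k
  proof -
    have "1 \<le> k \<Longrightarrow> k \<le> r \<Longrightarrow> j 1 + 2 \<le> j (k + 1)"
    proof (induction k rule: dec_induct)
      case base
      then show ?case using Suc.prems(3) by force
    next
      case (step i)
      then have "j (Suc i) + 2 \<le> j (Suc i + 1)" using Suc.prems(3) by simp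
      then show ?case using step by simp
    qed
    then show ?thesis using that by simp
  qed
  have j': "j (k + 1) = j' k + 2 + m" "1 \<le> j' k" if "k \<in> {1..r}" for k
    using far[OF that] jm by (auto simp: j'_def)
  have jn': "j' k \<le> n' - 1" if "k \<in> {1..r}" for k
    using far[OF that] Suc.prems(2)[rule_format, of "k + 1"] that by (auto simp: j'_def n'_def)
  let ?E = "\<lambda>T. \<forall>k\<in>{1..r}. second_diag n' T (j' k) = Some Alpha"
  have ev: "(\<forall>k\<in>{1..Suc r}. second_diag n T (j k) = Some Alpha)
    \<longleftrightarrow> drop_columns m T (Suc n', 1) = Some Alpha \<and> ?E (drop_columns 2 (drop_columns m T))" for T
  proof -
    have eq: "{1..Suc r} = insert 1 ((\<lambda>k. k + 1) ` {1..r})"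
      by (simp add: image_Suc_atLeastAtMost atLeastAtMost_insertL)
    have "(\<forall>k\<in>{1..Suc r}. second_diag n T (j k) = Some Alpha)
      \<longleftrightarrow> second_diag n T (j 1) = Some Alpha
        \<and> (\<forall>k\<in>{1..r}. second_diag n T (j (k + 1)) = Some Alpha)" unfolding eq by blast
    moreover have "second_diag n T (j 1) = drop_columns m T (Suc n', 1)"
      using jm by (simp add: second_diag_def drop_columns_def n)
    moreover have "second_diag n T (j (k + 1)) = second_diag n' (drop_columns 2 (drop_columns m T)) (j' k)"
      if "k \<in> {1..r}" for k
      using second_diag_drop_columns[OF j'(2)[OF that], of n' "2 + m" T] j'(1)[OF that]
      by (simp add: drop_columns_drop_columns n ac_simps)
    ultimately show ?thesis by simp
  qed
  have b': "b + real m > 0" using Suc.prems by simp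
  have IH: "measure_pmf.prob (random_tableau n' (inverse a) (inverse (b + real m))) {T. ?E T}
    = (\<Prod>k=1..r. (b + real m + real (j' (r - k + 1)) - 2 * real r + 2 * real k - 1) /
        ((a + (b + real m) + real n' - 2 * real r + 2 * real k - 1) *
         (a + (b + real m) + real n' - 2 * real r + 2 * real k - 2)))"
  proof (rule Suc.IH[OF b'])
    show "\<forall>k\<in>{1..r}. 1 \<le> j' k \<and> j' k \<le> n' - 1" using j' jn' by blast
    show "\<forall>k\<in>{1..<r}. j' k + 2 \<le> j' (k + 1)"
    proof
      fix k assume k: "k \<in> {1..<r}"
      then have "j (k + 1) + 2 \<le> j (k + 1 + 1)" using Suc.prems(3) by simp
      then show "j' k + 2 \<le> j' (k + 1)" using j'(1)[of k] j'(1)[of "k + 1"] k by simp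
    qed
  qed
  let ?f = "\<lambda>k. (b + real (j (Suc r - k + 1)) - 2 * real (Suc r) + 2 * real k - 1) /
        ((a + b + real n - 2 * real (Suc r) + 2 * real k - 1) *
         (a + b + real n - 2 * real (Suc r) + 2 * real k - 2))"
  have "measure_pmf.prob (random_tableau n (inverse a) (inverse b))
      {T. \<forall>k\<in>{1..Suc r}. second_diag n T (j k) = Some Alpha}
    = measure_pmf.prob (random_tableau (Suc (Suc n')) (inverse a) (inverse (b + real m)))
      {T. T (Suc n', 1) = Some Alpha \<and> ?E (drop_columns 2 T)}"
    unfolding ev using assms(1) Suc.prems(1)
    by (subst prob_drop_columns[of _ _ m "Suc (Suc n')", symmetric]) (simp_all add: n)
  also have "\<dots> = (b + real m) / ((a + (b + real m) + real n' + 1) * (a + (b + real m) + real n'))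
    * measure_pmf.prob (random_tableau n' (inverse a) (inverse (b + real m))) {T. ?E T}"
    by (rule prob_corner_Alpha[OF assms(1) b'])
  \<comment> \<open>The product runs through the positions backwards, so \<open>j 1\<close> belongs
    to the last index \<open>k = Suc r\<close>.\<close>
  also have "(b + real m) / ((a + (b + real m) + real n' + 1) * (a + (b + real m) + real n'))
    = ?f (Suc r)"
    using jm by (simp add: n algebra_simps)
  also have "measure_pmf.prob (random_tableau n' (inverse a) (inverse (b + real m))) {T. ?E T}
    = (\<Prod>k=1..r. ?f k)"
    unfolding IH
  proof (rule prod.cong[OF refl])
    fix k assume k: "k \<in> {1..r}"
    then have "Suc r - k + 1 = (r - k + 1) + 1" "r - k + 1 \<in> {1..r}" by auto
    then have "j (Suc r - k + 1) = j' (r - k + 1) + 2 + m"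
      using j'(1) by metis
    then have 1: "b + real (j (Suc r - k + 1)) - 2 * real (Suc r) + 2 * real k - 1
      = b + real m + real (j' (r - k + 1)) - 2 * real r + 2 * real k - 1" by simp
    \<comment> \<open>The size drops by \<open>m + 2\<close>: the shift of \<open>b\<close> makes up
      for \<open>m\<close>, and the smaller number of positions, entering with factor 2, for the
      rest.\<close>
    have 2: "a + (b + real m) + real n' - 2 * real r + 2 * real k - x
      = a + b + real n - 2 * real (Suc r) + 2 * real k - x" for x
      by (simp add: n)
    show "(b + real m + real (j' (r - k + 1)) - 2 * real r + 2 * real k - 1) /
        ((a + (b + real m) + real n' - 2 * real r + 2 * real k - 1) *
         (a + (b + real m) + real n' - 2 * real r + 2 * real k - 2)) = ?f k"
      unfolding 1 2 ..
  qed
  finally show ?case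
    by (simp add: prod.nat_ivl_Suc' mult.commute del: of_nat_Suc)
qed

section \<open>Adjacent positions, and the conclusion\<close>

lemma second_diag_adjacent_Alpha:
  assumes T: "T \<in> staircase_tableaux n" and "1 \<le> i" "i + 1 \<le> n - 1"
    and "second_diag n T i = Some Alpha"
  shows "second_diag n T (i + 1) \<noteq> Some Alpha"
proof
  assume A: "second_diag n T (i + 1) = Some Alpha"
  \<comment> \<open>This diagonal box is right of \<open>(n - i, i)\<close> and below
    \<open>(n - (i + 1), i + 1)\<close>.\<close>
  have "T (n - i, i + 1) \<noteq> None"
    using staircase_tableaux_diag[OF T, of "n - i" "i + 1"] assms(2,3) by simp
  then consider "T (n - i, i + 1) = Some Alpha" | "T (n - i, i + 1) = Some Beta"
    using not_None_symbol[of "T (n - i, i + 1)"] by blast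
  then show False
  proof cases
    case 1
    then have "T (n - (i + 1), i + 1) = None"
      using staircase_tableaux_Alpha[OF T, of "n - i" "i + 1"] assms(2,3) by simp
    then show False using A by (simp add: second_diag_def)
  next
    case 2
    then have "T (n - i, i) = None"
      using staircase_tableaux_Beta[OF T, of "n - i" "i + 1" i] by simp
    then show False using assms(4) by (simp add: second_diag_def)
  qed
qed

theorem theorem4p1:
  fixes n r :: nat and \<alpha> \<beta> a b :: real and j :: "nat \<Rightarrow> nat"
  assumes "n \<ge> 2"
    and "\<alpha> > 0" and "\<beta> > 0"
    and "a = inverse \<alpha>" and "b = inverse \<beta>"
    and "\<forall>k\<in>{1..r}. 1 \<le> j k \<and> j k \<le> n - 1"
    and "\<forall>k\<in>{1..<r}. j k < j (k + 1)"
  shows "((\<forall>k\<in>{1..<r}. j k + 2 \<le> j (k + 1)) \<longrightarrow>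
           measure_pmf.prob (random_tableau n \<alpha> \<beta>)
             {T. \<forall>k\<in>{1..r}. second_diag n T (j k) = Some Alpha} =
           (\<Prod>k=1..r. (b + real (j (r - k + 1)) - 2 * real r + 2 * real k - 1) /
             ((a + b + real n - 2 * real r + 2 * real k - 1) *
              (a + b + real n - 2 * real r + 2 * real k - 2)))) \<and>
         (\<not> (\<forall>k\<in>{1..<r}. j k + 2 \<le> j (k + 1)) \<longrightarrow>
           measure_pmf.prob (random_tableau n \<alpha> \<beta>)
             {T. \<forall>k\<in>{1..r}. second_diag n T (j k) = Some Alpha} = 0)"
proof (intro conjI impI)
  assume "\<forall>k\<in>{1..<r}. j k + 2 \<le> j (k + 1)"
  moreover have "a > 0" "b > 0" "\<alpha> = inverse a" "\<beta> = inverse b" using assms by auto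
  ultimately show "measure_pmf.prob (random_tableau n \<alpha> \<beta>)
             {T. \<forall>k\<in>{1..r}. second_diag n T (j k) = Some Alpha} =
           (\<Prod>k=1..r. (b + real (j (r - k + 1)) - 2 * real r + 2 * real k - 1) /
             ((a + b + real n - 2 * real r + 2 * real k - 1) *
              (a + b + real n - 2 * real r + 2 * real k - 2)))"
    using prob_second_diag_Alpha assms(6) by blast
next
  assume "\<not> (\<forall>k\<in>{1..<r}. j k + 2 \<le> j (k + 1))"
  \<comment> \<open>As \<open>j\<close> increases strictly, a gap smaller than 2 is a gap of exactly
    1.\<close>
  then obtain k where k: "k \<in> {1..<r}" and "j (k + 1) = j k + 1"
    using assms(7) by force
  moreover have "k \<in> {1..r}" "k + 1 \<in> {1..r}" using k by auto
  ultimately have "\<not> (\<forall>k\<in>{1..r}. second_diag n T (j k) = Some Alpha)"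
    if "T \<in> staircase_tableaux n" for T
    using second_diag_adjacent_Alpha[OF that, of "j k"] assms(6) by metis
  then show "measure_pmf.prob (random_tableau n \<alpha> \<beta>)
             {T. \<forall>k\<in>{1..r}. second_diag n T (j k) = Some Alpha} = 0"
    unfolding prob_random_tableau[OF assms(2,3)] by (subst sum.neutral) auto
qed

end
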